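(* Let $\mathcal{M}$ be a factor and let $P$ be a non-trivial projection in $\mathcal{M}$. Then the von Neumann algebra generated by $\{UPU^{*}:U\in\mathscr{U}(\mathcal{M})\}$ is $\mathcal{M}$.
   Context: A von Neumann algebra $\mathcal{M}$ on a Hilbert space $\mathscr{H}$ is a unital weak-operator-closed $*$-subalgebra of $B(\mathscr{H})$. It is a factor if $\mathcal{M}\cap\mathcal{M}'=\mathbb{C}I$, where $I$ is the identity of $\mathcal{M}$. All factors are assumed to have separable predual. $\mathscr{U}(\mathcal{M})$ is the set of unitary operators in $\mathcal{M}$. A projection $P$ is non-trivial if $P\neq 0$ and $P\neq I$. *)

theory Defs
  imports "HOL-Analysis.Analysis"
begin

text \<open>
  A complex Hilbert space is a complete real inner product space with a compatible complex
  structure. The real inner product is the real part of the complex one, so that the norm and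
  topology inherited from \<^class>\<open>real_inner\<close> are those of the complex Hilbert space. The complex
  inner product is linear in the first argument. No separability or positivity of the dimension
  is imposed.
\<close>

class complex_hilbert = real_inner + complete_space +
  fixes scaleC :: "complex \<Rightarrow> 'a \<Rightarrow> 'a"
    and cinner :: "'a \<Rightarrow> 'a \<Rightarrow> complex"
  assumes scaleC_add_right: "scaleC c (x + y) = scaleC c x + scaleC c y"
    and scaleC_add_left: "scaleC (c + d) x = scaleC c x + scaleC d x"
    and scaleC_scaleC: "scaleC c (scaleC d x) = scaleC (c * d) x"
    and scaleC_of_real: "scaleC (complex_of_real r) x = scaleR r x"
    and cinner_commute: "cinner x y = cnj (cinner y x)"
    and cinner_add_left: "cinner (x + y) z = cinner x z + cinner y z"
    and cinner_scaleC_left: "cinner (scaleC c x) y = c * cinner x y"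
    and Re_cinner: "Re (cinner x y) = inner x y"

instantiation complex :: complex_hilbert
begin

definition "scaleC_complex c x = c * (x :: complex)"
definition "cinner_complex x y = x * cnj (y :: complex)"

instance
  by standard
    (auto simp: scaleC_complex_def cinner_complex_def algebra_simps scaleR_conv_of_real
      inner_complex_def)

end

lemma cinner_self: "cinner x x = complex_of_real ((norm x)\<^sup>2)"
proof (rule complex_eqI)
  show "Re (cinner x x) = Re (complex_of_real ((norm x)\<^sup>2))"
    by (simp only: Re_cinner dot_square_norm Re_complex_of_real)
  have "Im (cinner x x) = - Im (cinner x x)"
    using arg_cong[OF cinner_commute[of x x], of Im] by (simp only: cnj.simps)
  then show "Im (cinner x x) = Im (complex_of_real ((norm x)\<^sup>2))"
    by (simp only: Im_complex_of_real)
qed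

lemma norm_scaleC: "norm (scaleC c x) = cmod c * norm x"
proof -
  have "cinner (scaleC c x) (scaleC c x) = c * cnj (c * cinner x x)"
    by (metis cinner_commute cinner_scaleC_left)
  also have "\<dots> = complex_of_real ((cmod c * norm x)\<^sup>2)"
    by (simp add: cinner_self power_mult_distrib flip: complex_norm_square mult.assoc)
  finally have "(norm (scaleC c x))\<^sup>2 = (cmod c * norm x)\<^sup>2"
    by (simp only: cinner_self of_real_eq_iff)
  then show ?thesis
    by (simp add: power2_eq_iff_nonneg)
qed

text \<open>
  \<^typ>\<open>'a \<Rightarrow>\<^sub>L 'a\<close> consists of the real-linear bounded operators; \<open>B(H)\<close> is the set of those that
  are complex-linear, with the same operator norm.
\<close>

definition bounded_ops :: "('a::complex_hilbert \<Rightarrow>\<^sub>L 'a) set" where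
  "bounded_ops = {T. \<forall>c x. blinfun_apply T (scaleC c x) = scaleC c (blinfun_apply T x)}"

lift_definition scalar_op :: "complex \<Rightarrow> 'a::complex_hilbert \<Rightarrow>\<^sub>L 'a" is scaleC
proof
  fix c :: complex and x y :: 'a and r :: real
  show "scaleC c (x + y) = scaleC c x + scaleC c y"
    by (rule scaleC_add_right)
  show "scaleC c (r *\<^sub>R x) = r *\<^sub>R scaleC c x"
    by (metis mult.commute scaleC_of_real scaleC_scaleC)
  show "\<exists>K. \<forall>x::'a. norm (scaleC c x) \<le> norm x * K"
    by (intro exI[of _ "cmod c"]) (simp add: norm_scaleC mult.commute)
qed

text \<open>
  The adjoint of a bounded operator; for elements of \<^const>\<open>bounded_ops\<close>, existence is given by the
  Riesz representation theorem.
\<close>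

definition adj :: "('a::complex_hilbert \<Rightarrow>\<^sub>L 'a) \<Rightarrow> 'a \<Rightarrow>\<^sub>L 'a" where
  "adj T = (THE S. \<forall>x y. cinner (blinfun_apply T x) y = cinner x (blinfun_apply S y))"

definition weak_operator_topology :: "('a::complex_hilbert \<Rightarrow>\<^sub>L 'a) topology" where
  "weak_operator_topology =
     pullback_topology bounded_ops (\<lambda>T. \<lambda>(x, y). cinner (blinfun_apply T x) y)
       (product_topology (\<lambda>_. euclidean) UNIV)"

definition von_neumann_algebra :: "('a::complex_hilbert \<Rightarrow>\<^sub>L 'a) set \<Rightarrow> bool" where
  "von_neumann_algebra M \<longleftrightarrow>
     M \<subseteq> bounded_ops \<and>
     id_blinfun \<in> M \<and>
     (\<forall>S\<in>M. \<forall>T\<in>M. S + T \<in> M) \<and>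
     (\<forall>c. \<forall>T\<in>M. scalar_op c o\<^sub>L T \<in> M) \<and>
     (\<forall>S\<in>M. \<forall>T\<in>M. S o\<^sub>L T \<in> M) \<and>
     (\<forall>T\<in>M. adj T \<in> M) \<and>
     closedin weak_operator_topology M"

definition commutant :: "('a::complex_hilbert \<Rightarrow>\<^sub>L 'a) set \<Rightarrow> ('a \<Rightarrow>\<^sub>L 'a) set" where
  "commutant M = {T \<in> bounded_ops. \<forall>S\<in>M. S o\<^sub>L T = T o\<^sub>L S}"

definition factor :: "('a::complex_hilbert \<Rightarrow>\<^sub>L 'a) set \<Rightarrow> bool" where
  "factor M \<longleftrightarrow> von_neumann_algebra M \<and> M \<inter> commutant M = range scalar_op"

definition generated_von_neumann_algebra ::
    "('a::complex_hilbert \<Rightarrow>\<^sub>L 'a) set \<Rightarrow> ('a \<Rightarrow>\<^sub>L 'a) set" where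
  "generated_von_neumann_algebra S = \<Inter>{N. von_neumann_algebra N \<and> S \<subseteq> N}"

definition unitaries :: "('a::complex_hilbert \<Rightarrow>\<^sub>L 'a) set \<Rightarrow> ('a \<Rightarrow>\<^sub>L 'a) set" where
  "unitaries M = {U \<in> M. adj U o\<^sub>L U = id_blinfun \<and> U o\<^sub>L adj U = id_blinfun}"

definition projection :: "('a::complex_hilbert \<Rightarrow>\<^sub>L 'a) \<Rightarrow> bool" where
  "projection P \<longleftrightarrow> P \<in> bounded_ops \<and> P o\<^sub>L P = P \<and> adj P = P"

definition square_summable :: "(nat \<Rightarrow> 'a::complex_hilbert) set" where
  "square_summable = {x. summable (\<lambda>n. (norm (x n))\<^sup>2)}"

text \<open>
  The ultraweak (\<open>\<sigma>\<close>-weak) topology on \<open>B(H)\<close> is the initial topology for the functionals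
  \<open>T \<mapsto> \<Sum>n. \<langle>T x\<^sub>n, y\<^sub>n\<rangle>\<close> with \<open>\<Sum>n. \<parallel>x\<^sub>n\<parallel>\<^sup>2 < \<infinity>\<close> and \<open>\<Sum>n. \<parallel>y\<^sub>n\<parallel>\<^sup>2 < \<infinity>\<close>.
\<close>

definition ultraweak_topology :: "('a::complex_hilbert \<Rightarrow>\<^sub>L 'a) topology" where
  "ultraweak_topology =
     pullback_topology bounded_ops
       (\<lambda>T. \<lambda>(x, y)\<in>square_summable \<times> square_summable.
          \<Sum>n. cinner (blinfun_apply T (x n)) (y n))
       (product_topology (\<lambda>_. euclidean) (square_summable \<times> square_summable))"

text \<open>
  The predual of \<open>M\<close> is the space of ultraweakly continuous linear functionals on \<open>M\<close>, with the
  norm of the dual of \<open>M\<close>. Functionals are normalised to \<^const>\<open>undefined\<close> outside \<open>M\<close>.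
\<close>

definition predual :: "('a::complex_hilbert \<Rightarrow>\<^sub>L 'a) set \<Rightarrow> (('a \<Rightarrow>\<^sub>L 'a) \<Rightarrow> complex) set" where
  "predual M = {\<phi> \<in> extensional M.
     (\<forall>S\<in>M. \<forall>T\<in>M. \<phi> (S + T) = \<phi> S + \<phi> T) \<and>
     (\<forall>c. \<forall>T\<in>M. \<phi> (scalar_op c o\<^sub>L T) = c * \<phi> T) \<and>
     continuous_map (subtopology ultraweak_topology M) euclidean \<phi>}"

text \<open>The last condition below says that \<open>\<phi> - \<psi>\<close> has dual norm at most \<open>e\<close>.\<close>

definition separable_predual :: "('a::complex_hilbert \<Rightarrow>\<^sub>L 'a) set \<Rightarrow> bool" where
  "separable_predual M \<longleftrightarrow>
     (\<exists>D. countable D \<and> D \<subseteq> predual M \<and>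
       (\<forall>\<phi>\<in>predual M. \<forall>e>0. \<exists>\<psi>\<in>D. \<forall>T\<in>M. cmod (\<phi> T - \<psi> T) \<le> e * norm T))"

end

theory Submission
  imports Defs
begin

text \<open>
  Let \<open>N\<close> be the von Neumann algebra generated by the unitary conjugates of \<open>P\<close>. Conjugation by a
  unitary \<open>U\<close> of \<open>M\<close> permutes the generators, so it maps \<open>N\<close> into itself. The proof exploits this
  invariance infinitesimally: if \<open>h = h\<^sup>*\<close> is in \<open>M\<close> and \<open>U\<close> is the Cayley transform
  \<open>(1 + ith)(1 - ith)\<^sup>-\<^sup>1\<close>, then
  \<open>UxU\<^sup>* - x = 2it (1 - ith)\<^sup>-\<^sup>1 [h, x] (1 + ith)\<^sup>-\<^sup>1\<close>, and dividing by \<open>2it\<close> and letting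
  \<open>t \<rightarrow> 0\<close> shows that \<open>[h, x]\<close> is in \<open>N\<close> for every \<open>x\<close> in \<open>N\<close>. By linearity \<open>N\<close> is a Lie ideal
  of \<open>M\<close> (lemma \<open>commutator_mem\<close>).

  A subalgebra that is a Lie ideal is either commutative or contains a nonzero two-sided ideal, by
  an argument of Herstein: \<open>a[x, y] = [ax, y] - [a, y]x\<close> and \<open>cb = bc - [b, c]\<close> give
  \<open>a[x, y]b \<in> N\<close> for all \<open>a, b \<in> M\<close> and \<open>x, y \<in> N\<close> (lemma \<open>sandwiched_commutator_mem\<close>).
  So all commutators of elements of \<open>N\<close> lie in the largest ideal \<open>I\<close> of \<open>M\<close> contained in \<open>N\<close>,
  which is weakly closed because \<open>N\<close> is.

  If \<open>I = 0\<close>, then \<open>P\<close> commutes with every \<open>[a, P]\<close>. For an idempotent this forces \<open>P\<close> to commute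
  with \<open>a\<close>, so \<open>P\<close> is central, hence a scalar, hence trivial. If \<open>I \<noteq> 0\<close>, then \<open>I\<close> contains the
  identity, as the only nonzero weakly closed ideal of a factor is the factor itself
  (lemma \<open>id_mem_weakly_closed_ideal_of_factor\<close>), and \<open>N = M\<close> follows.

  For the statement on ideals, let \<open>E\<close> be the projection onto the orthogonal complement of the common
  kernel of \<open>I\<close>. It commutes with \<open>M\<close>, and it lies in the weak closure of \<open>I\<close>: given finitely many
  vectors \<open>x\<^sub>i\<close>, minimise \<open>\<Sum>i. \<parallel>x\<^sub>i - T x\<^sub>i\<parallel>\<^sup>2\<close> over \<open>T \<in> I\<close>. The minimum need not be attained in
  \<open>I\<close>, but the vectors \<open>T x\<^sub>i\<close> of a minimising sequence converge, and orthogonality at the limit shows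
  that they converge to \<open>E x\<^sub>i\<close>. So \<open>E\<close> is a central element of \<open>I\<close>, that is, a nonzero
  scalar projection. The same minimisation, for a single vector and the kernel of
  a functional, gives the Riesz representation theorem, and with it the adjoint.
\<close>

section \<open>Hilbert space geometry\<close>

instance complex_hilbert \<subseteq> banach ..

lemma linear_coefficient_zero_if_quadratic_nonneg:
  fixes A B :: real
  assumes "A \<ge> 0" and "\<And>t. 0 \<le> t\<^sup>2 * A - 2 * t * B"
  shows "B = 0"
proof -
  define t where "t = B / (A + 1)"
  have B: "B = t * (A + 1)"
    using assms(1) by (simp add: t_def)
  have "0 \<le> - (t\<^sup>2 * (A + 2))"
    using assms(2)[of t] unfolding B by (simp add: algebra_simps power2_eq_square)
  then have "t = 0"
    using assms(1) by (simp add: mult_le_0_iff)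
  then show ?thesis
    by (simp add: B)
qed

lemma norm_diff_scaleR_squared:
  fixes a b :: "'a::real_inner"
  shows "(norm (a - t *\<^sub>R b))\<^sup>2 = (norm a)\<^sup>2 + (t\<^sup>2 * (norm b)\<^sup>2 - 2 * t * inner a b)"
  unfolding power2_norm_eq_inner
  by (simp add: inner_diff_left inner_diff_right inner_commute[of b a] power2_eq_square algebra_simps)

lemma eq_if_inner_eq:
  fixes y z :: "'a::real_inner"
  assumes "\<And>x. inner x y = inner x z"
  shows "y = z"
proof -
  have "inner (y - z) (y - z) = 0"
    using assms by (simp add: inner_diff_right)
  then show ?thesis
    by simp
qed

text \<open>
  This is the projection theorem for the closure of \<open>V\<close> in the Hilbert space of families indexed
  by \<open>F\<close>. Working with families directly lets the size of \<open>F\<close> vary, as neighbourhoods in the weak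
  operator topology require. The closest point \<open>z\<close> is the limit of a minimising sequence \<open>v\<close> in \<open>V\<close>.
\<close>

lemma projection_onto_family_space:
  fixes V :: "('i \<Rightarrow> 'a::{real_inner, complete_space}) set" and x :: "'i \<Rightarrow> 'a"
  assumes "finite F" and "V \<noteq> {}"
    and V_add: "\<And>u v. u \<in> V \<Longrightarrow> v \<in> V \<Longrightarrow> (\<lambda>i. u i + v i) \<in> V"
    and V_scale: "\<And>r v. v \<in> V \<Longrightarrow> (\<lambda>i. r *\<^sub>R v i) \<in> V"
  obtains z v where "\<And>n. v n \<in> V" and "\<And>i. i \<in> F \<Longrightarrow> (\<lambda>n. v n i) \<longlonglongrightarrow> z i"
    and "\<And>u. u \<in> V \<Longrightarrow> (\<Sum>i\<in>F. inner (x i - z i) (u i)) = 0"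
proof -
  define g where "g v = (\<Sum>i\<in>F. (norm (x i - v i))\<^sup>2)" for v
  define d where "d = Inf (g ` V)"
  have bdd: "bdd_below (g ` V)"
    by (rule bdd_belowI[of _ 0]) (auto simp: g_def intro!: sum_nonneg)
  have d_le: "d \<le> g v" if "v \<in> V" for v
    unfolding d_def using that bdd by (intro cInf_lower) auto
  have "\<exists>v\<in>V. g v < d + inverse (real (Suc n))" for n
  proof -
    have "Inf (g ` V) < d + inverse (real (Suc n))"
      unfolding d_def by simp
    then show ?thesis
      using cInf_less_iff[of "g ` V"] bdd \<open>V \<noteq> {}\<close> by auto
  qed
  then obtain v where vV: "\<And>n. v n \<in> V" and v_less: "\<And>n. g (v n) < d + inverse (real (Suc n))"
    by metis
  \<comment> \<open>The parallelogram law bounds the distance of two almost minimising families.\<close>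
  have close: "(norm (v n i - v m i))\<^sup>2 \<le> 2 * inverse (real (Suc n)) + 2 * inverse (real (Suc m))"
    if "i \<in> F" for i n m
  proof -
    let ?w = "\<lambda>i. (1/2) *\<^sub>R (v n i + v m i)"
    have "?w \<in> V"
      using V_scale[OF V_add[OF vV vV]] by simp
    have par: "(norm (v n i - v m i))\<^sup>2
        = 2 * (norm (x i - v n i))\<^sup>2 + 2 * (norm (x i - v m i))\<^sup>2 - 4 * (norm (x i - ?w i))\<^sup>2" for i
      by (simp add: power2_norm_eq_inner inner_simps inner_commute algebra_simps)
    have "(norm (v n i - v m i))\<^sup>2 \<le> (\<Sum>i\<in>F. (norm (v n i - v m i))\<^sup>2)"
      using that \<open>finite F\<close> by (intro member_le_sum) auto
    also have "\<dots> = 2 * g (v n) + 2 * g (v m) - 4 * g ?w"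
      unfolding par g_def by (simp add: sum.distrib sum_subtractf sum_distrib_left)
    also have "\<dots> \<le> 2 * inverse (real (Suc n)) + 2 * inverse (real (Suc m))"
      using v_less[of n] v_less[of m] d_le[OF \<open>?w \<in> V\<close>] by linarith
    finally show ?thesis .
  qed
  have "Cauchy (\<lambda>n. v n i)" if "i \<in> F" for i
  proof (rule CauchyI)
    fix e :: real
    assume "e > 0"
    then obtain k where k: "inverse (real (Suc k)) < e\<^sup>2 / 4"
      using reals_Archimedean[of "e\<^sup>2 / 4"] by auto
    have "norm (v n i - v m i) < e" if "n \<ge> k" "m \<ge> k" for n m
    proof -
      have "inverse (real (Suc n)) \<le> inverse (real (Suc k))"
        "inverse (real (Suc m)) \<le> inverse (real (Suc k))"
        using that by (auto simp: le_imp_inverse_le)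
      with close[OF \<open>i \<in> F\<close>, of n m] k have "(norm (v n i - v m i))\<^sup>2 < e\<^sup>2"
        by linarith
      then show ?thesis
        using \<open>e > 0\<close> by (simp add: power_less_imp_less_base)
    qed
    then show "\<exists>k. \<forall>m\<ge>k. \<forall>n\<ge>k. norm (v m i - v n i) < e"
      by blast
  qed
  then have "\<forall>i\<in>F. \<exists>y. (\<lambda>n. v n i) \<longlonglongrightarrow> y"
    using Cauchy_convergent convergent_def by blast
  then obtain z where z: "\<And>i. i \<in> F \<Longrightarrow> (\<lambda>n. v n i) \<longlonglongrightarrow> z i"
    by metis
  have g_lim: "(\<lambda>n. g (\<lambda>i. v n i + c i)) \<longlonglongrightarrow> g (\<lambda>i. z i + c i)" for c
    unfolding g_def by (intro tendsto_intros z)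
  have "g z \<le> d"
  proof (rule LIMSEQ_le)
    show "(\<lambda>n. g (v n)) \<longlonglongrightarrow> g z"
      using g_lim[of "\<lambda>_. 0"] by simp
    show "(\<lambda>n. d + inverse (real (Suc n))) \<longlonglongrightarrow> d"
      using tendsto_add[OF tendsto_const LIMSEQ_inverse_real_of_nat, of d] by simp
    show "\<exists>k. \<forall>n\<ge>k. g (v n) \<le> d + inverse (real (Suc n))"
      using v_less less_imp_le by blast
  qed
  show thesis
  proof (rule that[OF vV z])
    fix u
    assume "u \<in> V"
    show "(\<Sum>i\<in>F. inner (x i - z i) (u i)) = 0"
    proof (rule linear_coefficient_zero_if_quadratic_nonneg)
      show "0 \<le> (\<Sum>i\<in>F. (norm (u i))\<^sup>2)"
        by (intro sum_nonneg) auto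
      fix t :: real
      have "d \<le> g (\<lambda>i. z i + t *\<^sub>R u i)"
        using V_add[OF vV V_scale[OF \<open>u \<in> V\<close>]] g_lim
        by (intro LIMSEQ_le_const[OF g_lim]) (auto intro: d_le)
      also have "\<dots> = g z + (t\<^sup>2 * (\<Sum>i\<in>F. (norm (u i))\<^sup>2) - 2 * t * (\<Sum>i\<in>F. inner (x i - z i) (u i)))"
        unfolding g_def sum_distrib_left sum_subtractf[symmetric] sum.distrib[symmetric]
        by (intro sum.cong refl) (simp add: diff_diff_eq flip: norm_diff_scaleR_squared)
      finally show "0 \<le> t\<^sup>2 * (\<Sum>i\<in>F. (norm (u i))\<^sup>2) - 2 * t * (\<Sum>i\<in>F. inner (x i - z i) (u i))"
        using \<open>g z \<le> d\<close> by linarith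
    qed
  qed
qed

text \<open>
  The representing vector is a multiple of the component \<open>w\<close> orthogonal to the kernel of \<open>f\<close> of a
  vector with \<open>f x = 1\<close>; the families are indexed by the one-element type.
\<close>

lemma riesz_representation:
  fixes f :: "'a::{real_inner, complete_space} \<Rightarrow> real"
  assumes "bounded_linear f"
  shows "\<exists>z. \<forall>x. f x = inner x z"
proof (cases "\<forall>x. f x = 0")
  case True
  then show ?thesis
    by (intro exI[of _ 0]) simp
next
  case False
  interpret bounded_linear f by fact
  obtain y where "f y \<noteq> 0"
    using False by blast
  define x where "x = (1 / f y) *\<^sub>R y"
  have "f x = 1"
    using \<open>f y \<noteq> 0\<close> by (simp add: x_def scaleR)
  define V where "V = {v :: unit \<Rightarrow> 'a. f (v ()) = 0}"
  have V_add: "(\<lambda>i. u i + v i) \<in> V" if "u \<in> V" "v \<in> V" for u v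
    using that by (simp add: V_def local.add)
  have V_scale: "(\<lambda>i. r *\<^sub>R v i) \<in> V" if "v \<in> V" for r v
    using that by (simp add: V_def local.scaleR)
  have "(\<lambda>_. 0) \<in> V"
    by (simp add: V_def zero)
  then have "V \<noteq> {}"
    by blast
  obtain z v where v: "\<And>n. v n \<in> V" and lim: "\<And>i. i \<in> {()} \<Longrightarrow> (\<lambda>n. v n i) \<longlonglongrightarrow> z i"
    and orth: "\<And>u. u \<in> V \<Longrightarrow> (\<Sum>i\<in>{()}. inner (x - z i) (u i)) = 0"
    by (rule projection_onto_family_space[of "{()}" V "\<lambda>_. x",
          OF finite.insertI[OF finite.emptyI] \<open>V \<noteq> {}\<close> V_add V_scale]) (assumption | rule that)+
  have "(\<lambda>n. f (v n ())) \<longlonglongrightarrow> f (z ())"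
    using lim by (intro tendsto) auto
  then have "f (z ()) = 0"
    using v by (simp add: V_def LIMSEQ_const_iff)
  define w where "w = x - z ()"
  have "f w = 1"
    using \<open>f x = 1\<close> \<open>f (z ()) = 0\<close> by (simp add: w_def diff)
  then have "w \<noteq> 0"
    using zero by auto
  have w_orth: "inner w (y - f y *\<^sub>R w) = 0" for y
    using orth[of "\<lambda>_. y - f y *\<^sub>R w"] \<open>f w = 1\<close> by (simp add: V_def w_def diff scaleR)
  have inner_w: "inner w y = f y * inner w w" for y
    using w_orth[of y] by (simp add: inner_diff_right)
  have "f y = inner y ((1 / inner w w) *\<^sub>R w)" for y
    using \<open>w \<noteq> 0\<close> inner_w[of y] by (simp add: inner_commute[of y w])
  then show ?thesis
    by blast
qed

text \<open>
  The projection onto \<open>K\<close> is given together with the uniqueness of the decomposition: all later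
  properties of the projection, such as commuting with an operator that preserves both subspaces,
  are instances of uniqueness.
\<close>

lemma operator_of_orthogonal_decomposition:
  fixes W K :: "'a::real_inner set"
  assumes W: "subspace W" and K: "subspace K"
    and orth: "\<And>w k. w \<in> W \<Longrightarrow> k \<in> K \<Longrightarrow> inner w k = 0"
    and dec: "\<And>x. \<exists>k\<in>K. x - k \<in> W"
  obtains E :: "'a \<Rightarrow>\<^sub>L 'a" where "\<And>x. E x \<in> K" and "\<And>x. x - E x \<in> W" and "\<And>x k. k \<in> K \<Longrightarrow> x - k \<in> W \<Longrightarrow> E x = k"
proof -
  obtain e where eK: "\<And>x. e x \<in> K" and eW: "\<And>x. x - e x \<in> W"
    using dec by metis
  have uniq: "e x = k" if "k \<in> K" "x - k \<in> W" for x k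
  proof -
    have "e x - k \<in> K"
      using eK that by (simp add: K subspace_diff)
    moreover have "(x - k) - (x - e x) \<in> W"
      using eW that W by (blast intro: subspace_diff)
    then have "e x - k \<in> W"
      by simp
    ultimately have "inner (e x - k) (e x - k) = 0"
      by (intro orth)
    then show ?thesis
      by simp
  qed
  have "bounded_linear e"
  proof (rule bounded_linear_intro[where K = 1])
    fix x y :: 'a
    have "(x - e x) + (y - e y) \<in> W"
      using eW W by (intro subspace_add) auto
    then show "e (x + y) = e x + e y"
      using eK K by (intro uniq) (auto simp: subspace_add algebra_simps)
  next
    fix r and x :: 'a
    have "r *\<^sub>R (x - e x) \<in> W"
      using eW W by (intro subspace_scale) auto
    then show "e (r *\<^sub>R x) = r *\<^sub>R e x"
      using eK K by (intro uniq) (auto simp: subspace_scale algebra_simps)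
  next
    fix x :: 'a
    have "(norm x)\<^sup>2 = (norm (x - e x))\<^sup>2 + (norm (e x))\<^sup>2"
      using orth[OF eW eK, of x x] by (simp add: power2_norm_eq_inner inner_simps inner_commute)
    then have "(norm (e x))\<^sup>2 \<le> (norm x)\<^sup>2"
      by simp
    then show "norm (e x) \<le> norm x * 1"
      by simp
  qed
  then show thesis
    using that[of "Blinfun e"] eK eW uniq by (simp add: bounded_linear_Blinfun_apply)
qed

section \<open>Adjoints\<close>

lemma scaleC_one [simp]: "scaleC 1 (x::'a::complex_hilbert) = x"
  using scaleC_of_real[of 1 x] by simp

lemma cinner_add_right: "cinner x (y + z) = cinner x y + cinner x (z::'a::complex_hilbert)"
  by (metis cinner_add_left cinner_commute complex_cnj_add)

lemma cinner_scaleC_right: "cinner x (scaleC c y) = cnj c * cinner x (y::'a::complex_hilbert)"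
  by (metis cinner_commute cinner_scaleC_left complex_cnj_mult)

lemma inner_scaleC_left: "inner (scaleC c x) y = inner x (scaleC (cnj c) (y::'a::complex_hilbert))"
  by (simp flip: Re_cinner add: cinner_scaleC_left cinner_scaleC_right)

lemma cinner_eq_inner:
  "cinner x y = Complex (inner x y) (inner (scaleC (-\<i>) x) (y::'a::complex_hilbert))"
  by (rule complex_eqI) (auto simp: cinner_scaleC_left simp flip: Re_cinner)

text \<open>The factor 2 spares the passage to the optimal constant 1; only continuity matters below.\<close>

lemma norm_cinner_le: "cmod (cinner x y) \<le> 2 * (norm x * norm (y::'a::complex_hilbert))"
proof -
  have "cmod (cinner x y) \<le> \<bar>inner x y\<bar> + \<bar>inner (scaleC (-\<i>) x) y\<bar>"
    using cmod_le[of "cinner x y"] by (simp add: cinner_eq_inner)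
  also have "\<dots> \<le> norm x * norm y + norm (scaleC (-\<i>) x) * norm y"
    by (intro add_mono Cauchy_Schwarz_ineq2)
  finally show ?thesis
    by (simp add: norm_scaleC)
qed

lemma bounded_ops_scaleC: "T \<in> bounded_ops \<Longrightarrow> T (scaleC c x) = scaleC c (T x)"
  by (simp add: bounded_ops_def)

lemma cinner_diff_left: "cinner (x - y) z = cinner x z - cinner y (z::'a::complex_hilbert)"
  using cinner_add_left[of "x - y" y z] by simp

lemma cinner_diff_right: "cinner x (y - z) = cinner x y - cinner x (z::'a::complex_hilbert)"
  using cinner_add_right[of x "y - z" z] by simp

lemma scaleC_diff_right: "scaleC c (x - y) = scaleC c x - scaleC c (y::'a::complex_hilbert)"
  using scaleC_add_right[of c "x - y" y] by simp

lemma scaleC_minus_left: "scaleC (- c) x = - scaleC c (x::'a::complex_hilbert)"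
proof -
  have "scaleC 0 x = 0"
    using scaleC_of_real[of 0 x] by simp
  then show ?thesis
    using scaleC_add_left[of c "- c" x] by (simp add: eq_neg_iff_add_eq_0 add.commute)
qed

lemma adj_eqI:
  assumes "\<And>x y. cinner (blinfun_apply T x) y = cinner x (blinfun_apply S y)"
  shows "adj T = S"
  unfolding adj_def
proof (rule the_equality)
  fix S'
  assume S': "\<forall>x y. cinner (blinfun_apply T x) y = cinner x (blinfun_apply S' y)"
  show "S' = S"
  proof (rule blinfun_eqI)
    fix y
    show "S' y = S y"
    proof (rule eq_if_inner_eq)
      fix x
      have "cinner x (S' y) = cinner x (S y)"
        using S' assms[of x y] by simp
      then show "inner x (S' y) = inner x (S y)"
        unfolding Re_cinner[symmetric] by simp
    qed
  qed
qed (use assms in blast)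

text \<open>
  The representation theorem for the real inner product suffices: a complex-linear operator has
  the same adjoint for the real inner product as for the complex one, since the
  imaginary part of the latter is \<open>inner (-i x) y\<close>.
\<close>

lemma cinner_adj:
  assumes "T \<in> bounded_ops"
  shows "cinner (T x) y = cinner x (adj T y)"
proof -
  have "\<exists>z. \<forall>x. inner (T x) y = inner x z" for y
    using blinfun.bounded_linear_right bounded_linear_inner_left_comp
    by (intro riesz_representation) blast
  then obtain s where s: "\<And>x y. inner (T x) y = inner x (s y)"
    by metis
  have "bounded_linear s"
  proof (rule bounded_linear_intro[where K = "norm T"])
    fix y
    have "norm (s y) * norm (s y) = inner (T (s y)) y"
      by (simp add: s flip: power2_eq_square power2_norm_eq_inner)
    also have "\<dots> \<le> norm (T (s y)) * norm y"
      by (rule norm_cauchy_schwarz)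
    also have "\<dots> \<le> (norm T * norm (s y)) * norm y"
      by (intro mult_right_mono norm_blinfun) auto
    finally show "norm (s y) \<le> norm y * norm T"
      by (cases "norm (s y) = 0") (auto simp: algebra_simps)
  qed (rule eq_if_inner_eq, simp add: inner_add_right flip: s)+
  then have s_apply: "blinfun_apply (Blinfun s) = s"
    by (rule bounded_linear_Blinfun_apply)
  have "cinner (T x) y = cinner x (s y)" for x y
    using assms by (simp add: cinner_eq_inner bounded_ops_scaleC flip: s)
  then have "cinner (T x) y = cinner x (s y)" "adj T = Blinfun s"
    by (auto intro!: adj_eqI simp: s_apply)
  then show ?thesis
    by (simp add: s_apply)
qed

lemma inner_adj: "T \<in> bounded_ops \<Longrightarrow> inner (T x) y = inner x (adj T y)"
  unfolding Re_cinner[symmetric] by (simp only: cinner_adj)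

lemma adj_bounded_ops:
  assumes "T \<in> bounded_ops"
  shows "adj T \<in> bounded_ops"
proof -
  have "adj T (scaleC c y) = scaleC c (adj T y)" for c y
  proof (rule eq_if_inner_eq)
    fix x
    have "inner x (adj T (scaleC c y)) = inner (T (scaleC (cnj c) x)) y"
      using assms by (simp add: bounded_ops_scaleC inner_scaleC_left flip: inner_adj)
    also have "\<dots> = inner x (scaleC c (adj T y))"
      using assms by (simp add: inner_adj inner_scaleC_left)
    finally show "inner x (adj T (scaleC c y)) = inner x (scaleC c (adj T y))" .
  qed
  then show ?thesis
    by (simp add: bounded_ops_def)
qed

lemma blinfun_compose_assoc: "(S o\<^sub>L T) o\<^sub>L U = S o\<^sub>L (T o\<^sub>L U)"
  by (rule blinfun_eqI) simp

lemma blinfun_compose_id [simp]: "id_blinfun o\<^sub>L T = T" "T o\<^sub>L id_blinfun = T"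
  by (simp_all add: blinfun_eqI)

lemma scalar_op_apply [simp]: "blinfun_apply (scalar_op c) x = scaleC c x"
  by transfer simp

lemma bounded_ops_compose: "S \<in> bounded_ops \<Longrightarrow> T \<in> bounded_ops \<Longrightarrow> S o\<^sub>L T \<in> bounded_ops"
  by (simp add: bounded_ops_def)

lemma cinner_adj_left:
  assumes "T \<in> bounded_ops"
  shows "cinner (adj T x) y = cinner x (T y)"
  using cinner_adj[OF assms, of y x] cinner_commute[of "adj T x" y] cinner_commute[of x "T y"] by simp

lemma adj_adj: "T \<in> bounded_ops \<Longrightarrow> adj (adj T) = T"
  by (intro adj_eqI cinner_adj_left)

lemma adj_compose: "S \<in> bounded_ops \<Longrightarrow> T \<in> bounded_ops \<Longrightarrow> adj (S o\<^sub>L T) = adj T o\<^sub>L adj S"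
  by (intro adj_eqI) (simp add: cinner_adj)

lemma adj_add: "S \<in> bounded_ops \<Longrightarrow> T \<in> bounded_ops \<Longrightarrow> adj (S + T) = adj S + adj T"
  by (intro adj_eqI) (simp add: cinner_adj blinfun.add_left cinner_add_left cinner_add_right)

lemma adj_scalar: "T \<in> bounded_ops \<Longrightarrow> adj (scalar_op c o\<^sub>L T) = scalar_op (cnj c) o\<^sub>L adj T"
  by (intro adj_eqI) (simp add: cinner_adj cinner_scaleC_left cinner_scaleC_right)


section \<open>The weak operator topology\<close>

lemma topspace_weak_operator_topology [simp]: "topspace weak_operator_topology = bounded_ops"
  by (auto simp: weak_operator_topology_def topspace_pullback_topology)

lemma bounded_linear_cinner_left: "bounded_linear (\<lambda>x. cinner x (y::'a::complex_hilbert))"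
proof (rule bounded_linear_intro[where K = "2 * norm y"])
  show "cinner (r *\<^sub>R x) y = r *\<^sub>R cinner x y" for r x
    unfolding scaleC_of_real[of r x, symmetric] cinner_scaleC_left scaleR_conv_of_real ..
  show "cmod (cinner x y) \<le> norm x * (2 * norm y)" for x
    using norm_cinner_le[of x y] by (simp add: mult_ac)
qed (rule cinner_add_left)

text \<open>
  A basic weak operator neighbourhood constrains only finitely many matrix coefficients, hence only
  the values at finitely many vectors; the approximating sequence may depend on these vectors.
\<close>

lemma mem_weakly_closed_if_pointwise_limit:
  fixes T :: "'a::complex_hilbert \<Rightarrow>\<^sub>L 'a"
  assumes closed: "closedin weak_operator_topology C" and T: "T \<in> bounded_ops"
    and lim: "\<And>F. finite F \<Longrightarrow>
      \<exists>X. (\<forall>n. X n \<in> C) \<and> (\<forall>x\<in>F. (\<lambda>n::nat. blinfun_apply (X n) x) \<longlonglongrightarrow> T x)"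
  shows "T \<in> C"
proof (rule ccontr)
  let ?f = "\<lambda>T :: 'a \<Rightarrow>\<^sub>L 'a. \<lambda>(x, y). cinner (T x) y"
  assume "T \<notin> C"
  have "openin weak_operator_topology (bounded_ops - C)"
    using closed by (simp add: closedin_def)
  then obtain Q where Q: "openin (product_topology (\<lambda>_. euclidean) UNIV) Q"
      and C: "bounded_ops - C = ?f -` Q \<inter> bounded_ops"
    unfolding weak_operator_topology_def openin_pullback_topology by blast
  have "?f T \<in> Q"
    using T \<open>T \<notin> C\<close> C by blast
  then obtain B where B: "?f T \<in> (\<Pi>\<^sub>E i\<in>UNIV. B i)" "\<And>i. openin euclidean (B i)"
      "finite {i. B i \<noteq> topspace euclidean}" "(\<Pi>\<^sub>E i\<in>UNIV. B i) \<subseteq> Q"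
    using product_topology_open_contains_basis[OF Q] by blast
  \<comment> \<open>The matrix coefficients that the basic neighbourhood constrains.\<close>
  define G where "G = {i. B i \<noteq> UNIV}"
  have "finite G"
    using B(3) by (simp add: G_def)
  then obtain X where X: "\<And>n. X n \<in> C"
      and Xlim: "\<And>x. x \<in> fst ` G \<Longrightarrow> (\<lambda>n. blinfun_apply (X n) x) \<longlonglongrightarrow> T x"
    using lim[of "fst ` G"] by auto
  have "\<forall>\<^sub>F n in sequentially. \<forall>i\<in>G. ?f (X n) i \<in> B i"
  proof (rule eventually_ball_finite[OF \<open>finite G\<close>], rule ballI)
    fix i
    assume "i \<in> G"
    obtain x y where i: "i = (x, y)"
      by (cases i)
    have "(\<lambda>n. cinner (X n x) y) \<longlonglongrightarrow> cinner (T x) y"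
      using Xlim[of x] \<open>i \<in> G\<close>
      by (intro bounded_linear.tendsto[OF bounded_linear_cinner_left]) (force simp: i)
    moreover have "open (B i)" "cinner (T x) y \<in> B i"
      using B(1,2) by (auto simp: PiE_iff i dest: spec[of _ i])
    ultimately show "\<forall>\<^sub>F n in sequentially. ?f (X n) i \<in> B i"
      by (simp add: i topological_tendstoD)
  qed
  then obtain n where "\<forall>i\<in>G. ?f (X n) i \<in> B i"
    using eventually_happens'[OF sequentially_bot] by blast
  then have "?f (X n) \<in> Q"
    by (intro subsetD[OF B(4)]) (auto simp: G_def PiE_iff)
  moreover have "X n \<in> bounded_ops"
    using X closedin_subset[OF closed] by auto
  ultimately show False
    using X C by blast
qed

lemma mem_weakly_closed_if_norm_limit:
  fixes T :: "'a::complex_hilbert \<Rightarrow>\<^sub>L 'a"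
  assumes closed: "closedin weak_operator_topology C" and X: "\<And>n. X n \<in> C" and lim: "X \<longlonglongrightarrow> T"
  shows "T \<in> C"
proof -
  have pointwise: "(\<lambda>n. X n x) \<longlonglongrightarrow> T x" for x
    using lim by (intro tendsto_intros)
  have "T (scaleC c x) = scaleC c (T x)" for c x
  proof (rule LIMSEQ_unique[OF pointwise])
    have "X n \<in> bounded_ops" for n
      using X closedin_subset[OF closed] by auto
    then have "(\<lambda>n. X n (scaleC c x)) = (\<lambda>n. scalar_op c (X n x))"
      by (simp add: bounded_ops_scaleC)
    then show "(\<lambda>n. X n (scaleC c x)) \<longlonglongrightarrow> scaleC c (T x)"
      using blinfun.tendsto[OF tendsto_const pointwise, of "scalar_op c" x] by simp
  qed
  then have "T \<in> bounded_ops"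
    by (simp add: bounded_ops_def)
  then show ?thesis
    using X pointwise by (intro mem_weakly_closed_if_pointwise_limit[OF closed]) auto
qed

text \<open>The matrix coefficients of \<open>A T B\<close> are coefficients of \<open>T\<close>, since \<open>\<langle>A T B x, y\<rangle> = \<langle>T (B x), A\<^sup>* y\<rangle>\<close>.\<close>

lemma continuous_map_sandwich:
  assumes A: "A \<in> bounded_ops" and B: "B \<in> bounded_ops"
  shows "continuous_map weak_operator_topology weak_operator_topology (\<lambda>T. A o\<^sub>L T o\<^sub>L B)"
proof -
  let ?f = "\<lambda>T :: 'a \<Rightarrow>\<^sub>L 'a. \<lambda>(x, y). cinner (T x) y"
  let ?g = "\<lambda>\<phi> :: 'a \<times> 'a \<Rightarrow> complex. \<lambda>(x, y). \<phi> (B x, adj A y)"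
  let ?P = "product_topology (\<lambda>_. euclidean) UNIV :: ('a \<times> 'a \<Rightarrow> complex) topology"
  have "continuous_map ?P ?P ?g"
    unfolding continuous_map_componentwise_UNIV
    by (auto intro: continuous_map_product_projection)
  then have "continuous_map weak_operator_topology ?P (?g \<circ> ?f)"
    unfolding weak_operator_topology_def by (rule continuous_map_pullback)
  also have "?g \<circ> ?f = ?f \<circ> (\<lambda>T. A o\<^sub>L T o\<^sub>L B)"
    by (auto simp: fun_eq_iff cinner_adj[OF A])
  finally have "continuous_map weak_operator_topology ?P (?f \<circ> (\<lambda>T. A o\<^sub>L T o\<^sub>L B))" .
  moreover have "topspace weak_operator_topology \<subseteq> (\<lambda>T. A o\<^sub>L T o\<^sub>L B) -` bounded_ops"
    using A B by (auto intro: bounded_ops_compose)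
  ultimately show ?thesis
    by (subst (2) weak_operator_topology_def) (rule continuous_map_pullback')
qed

lemma closedin_sandwich:
  assumes "A \<in> bounded_ops" and "B \<in> bounded_ops" and "closedin weak_operator_topology C"
  shows "closedin weak_operator_topology {T \<in> bounded_ops. A o\<^sub>L T o\<^sub>L B \<in> C}"
  using closedin_continuous_map_preimage[OF continuous_map_sandwich[OF assms(1,2)] assms(3)] by simp

section \<open>Von Neumann algebras\<close>

context
  fixes K :: "('a::complex_hilbert \<Rightarrow>\<^sub>L 'a) set"
  assumes K: "von_neumann_algebra K"
begin

lemma vna_bounded_ops: "T \<in> K \<Longrightarrow> T \<in> bounded_ops"
  and vna_id: "id_blinfun \<in> K"
  and vna_add: "S \<in> K \<Longrightarrow> T \<in> K \<Longrightarrow> S + T \<in> K"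
  and vna_scalar: "T \<in> K \<Longrightarrow> scalar_op c o\<^sub>L T \<in> K"
  and vna_compose: "S \<in> K \<Longrightarrow> T \<in> K \<Longrightarrow> S o\<^sub>L T \<in> K"
  and vna_adj: "T \<in> K \<Longrightarrow> adj T \<in> K"
  and vna_closed: "closedin weak_operator_topology K"
  using K by (auto simp: von_neumann_algebra_def)

lemma vna_scaleR:
  assumes "T \<in> K"
  shows "r *\<^sub>R T \<in> K"
proof -
  have "r *\<^sub>R T = scalar_op (complex_of_real r) o\<^sub>L T"
    by (rule blinfun_eqI) (simp add: scaleC_of_real blinfun.scaleR_left)
  then show ?thesis
    using assms by (simp add: vna_scalar)
qed

lemma vna_zero: "0 \<in> K"
  using vna_scaleR[OF vna_id, of 0] by simp

lemma vna_diff: "S \<in> K \<Longrightarrow> T \<in> K \<Longrightarrow> S - T \<in> K"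
  using vna_add[of S "(-1) *\<^sub>R T"] vna_scaleR[of T "-1"] by simp

lemma vna_sum: "(\<And>n. n \<in> A \<Longrightarrow> X n \<in> K) \<Longrightarrow> sum X A \<in> K"
  by (induction A rule: infinite_finite_induct) (auto intro: vna_zero vna_add)

lemma vna_unitary_conjugate:
  assumes U: "U \<in> bounded_ops" "adj U o\<^sub>L U = id_blinfun" "U o\<^sub>L adj U = id_blinfun"
  shows "von_neumann_algebra {T \<in> bounded_ops. U o\<^sub>L T o\<^sub>L adj U \<in> K}"
proof -
  have UU: "adj U (U x) = x" "U (adj U x) = x" for x
    using U(2,3) by (metis blinfun_apply_id_blinfun blinfun_apply_blinfun_compose)+
  have adjU: "adj U \<in> bounded_ops"
    using U(1) by (rule adj_bounded_ops)
  have "U o\<^sub>L id_blinfun o\<^sub>L adj U = id_blinfun"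
    by (simp add: U(3))
  moreover have "U o\<^sub>L (S + T) o\<^sub>L adj U = (U o\<^sub>L S o\<^sub>L adj U) + (U o\<^sub>L T o\<^sub>L adj U)" for S T
    by (rule blinfun_eqI) (simp add: blinfun.bilinear_simps)
  moreover have "U o\<^sub>L (scalar_op c o\<^sub>L T) o\<^sub>L adj U = scalar_op c o\<^sub>L (U o\<^sub>L T o\<^sub>L adj U)" for c T
    by (rule blinfun_eqI) (simp add: bounded_ops_scaleC[OF U(1)])
  moreover have "U o\<^sub>L (S o\<^sub>L T) o\<^sub>L adj U = (U o\<^sub>L S o\<^sub>L adj U) o\<^sub>L (U o\<^sub>L T o\<^sub>L adj U)" for S T
    by (rule blinfun_eqI) (simp add: UU)
  moreover have "U o\<^sub>L adj T o\<^sub>L adj U = adj (U o\<^sub>L T o\<^sub>L adj U)" if "T \<in> bounded_ops" for T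
    using that U(1) adjU
    by (simp add: adj_compose bounded_ops_compose adj_adj blinfun_compose_assoc)
  ultimately show ?thesis
    unfolding von_neumann_algebra_def
    using closedin_sandwich[OF U(1) adjU vna_closed]
    by (auto intro!: vna_id vna_add vna_scalar vna_compose vna_adj bounded_ops_compose adj_bounded_ops)
      (auto simp: bounded_ops_def blinfun.bilinear_simps scaleC_add_right scaleC_scaleC mult.commute)
qed

text \<open>
  The inverse of \<open>1 - k\<close> is the sum of the Neumann series, which stays in the algebra because the
  algebra is norm closed. The norm estimate comes from \<open>R - 1 = k R\<close>.
\<close>

lemma vna_inverse_one_minus:
  assumes "k \<in> K" and "norm k < 1"
  obtains R where "R \<in> K" and "\<And>x. R (x - k x) = x" and "\<And>x. R x - k (R x) = x"
    and "norm (R - id_blinfun) \<le> norm k / (1 - norm k)"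
proof -
  define p where "p n = ((\<lambda>T. k o\<^sub>L T) ^^ n) id_blinfun" for n
  have p_0: "p 0 = id_blinfun" and p_Suc: "p (Suc n) = k o\<^sub>L p n" for n
    by (simp_all add: p_def)
  have p_comm: "p n o\<^sub>L k = k o\<^sub>L p n" for n
    by (induction n) (auto simp: p_0 p_Suc blinfun_compose_assoc intro: blinfun_eqI)
  have p_K: "p n \<in> K" for n
    by (induction n) (auto simp: p_0 p_Suc intro: vna_id vna_compose assms)
  have p_norm: "norm (p n) \<le> norm k ^ n" for n
  proof (induction n)
    case (Suc n)
    have "norm (p (Suc n)) \<le> norm k * norm (p n)"
      unfolding p_Suc by (rule norm_blinfun_compose)
    also have "\<dots> \<le> norm k * norm k ^ n"
      by (intro mult_left_mono Suc) auto
    finally show ?case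
      by simp
  qed (simp add: p_0 norm_blinfun_id_le)
  have summ: "summable p"
  proof (rule summable_comparison_test')
    show "summable (\<lambda>n. norm k ^ n)"
      using assms(2) by (intro summable_geometric) simp
    show "norm (p n) \<le> norm k ^ n" if "n \<ge> 0" for n
      by (rule p_norm)
  qed
  define R where "R = suminf p"
  have tail: "(\<lambda>n. p (Suc n)) sums (R - id_blinfun)"
    using summ sums_Suc_iff[of p] by (simp add: R_def p_0 summable_sums)
  have "(\<lambda>n. k o\<^sub>L p n) sums (k o\<^sub>L R)" "(\<lambda>n. p n o\<^sub>L k) sums (R o\<^sub>L k)"
    unfolding R_def
    by (auto intro!: summable_sums summ
        bounded_linear.sums[OF bounded_bilinear.bounded_linear_left[OF bounded_bilinear_blinfun_compose]]
        bounded_linear.sums[OF bounded_bilinear.bounded_linear_right[OF bounded_bilinear_blinfun_compose]])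
  then have kR: "k o\<^sub>L R = R - id_blinfun" and Rk: "R o\<^sub>L k = R - id_blinfun"
    using tail by (auto simp: p_Suc p_comm dest: sums_unique2)
  show thesis
  proof
    show "R \<in> K"
    proof (rule mem_weakly_closed_if_norm_limit[OF vna_closed])
      show "(\<lambda>n. sum p {..<n}) \<longlonglongrightarrow> R"
        unfolding R_def using summ by (rule summable_LIMSEQ)
    qed (auto intro: vna_sum p_K)
    show "R (x - k x) = x" for x
      using arg_cong[OF Rk, of "\<lambda>T. blinfun_apply T x"] by (simp add: blinfun.bilinear_simps)
    show "R x - k (R x) = x" for x
      using arg_cong[OF kR, of "\<lambda>T. blinfun_apply T x"] by (simp add: blinfun.bilinear_simps)
    have "norm R \<le> norm (R - id_blinfun) + 1"
      using norm_triangle_ineq[of "R - id_blinfun" id_blinfun] norm_blinfun_id_le[where 'a='a] by simp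
    then have "norm (k o\<^sub>L R) \<le> norm k * (norm (R - id_blinfun) + 1)"
      by (intro order_trans[OF norm_blinfun_compose] mult_left_mono) auto
    then show "norm (R - id_blinfun) \<le> norm k / (1 - norm k)"
      using assms(2) by (simp add: kR field_simps)
  qed
qed

end

lemma generated_vna:
  assumes "von_neumann_algebra M" and "S \<subseteq> M"
  shows "von_neumann_algebra (generated_von_neumann_algebra S)"
    and "generated_von_neumann_algebra S \<subseteq> M" and "S \<subseteq> generated_von_neumann_algebra S"
proof -
  show "von_neumann_algebra (generated_von_neumann_algebra S)"
    using assms unfolding von_neumann_algebra_def[of "generated_von_neumann_algebra S"]
    unfolding generated_von_neumann_algebra_def
    by (intro conjI closedin_Inter)
      (auto intro: vna_id vna_add vna_scalar vna_compose vna_adj vna_closed dest: vna_bounded_ops)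
qed (use assms in \<open>auto simp: generated_von_neumann_algebra_def\<close>)


section \<open>Weakly closed ideals of factors\<close>

text \<open>
  The vectors \<open>x - z x\<close> are orthogonal, in the sum over \<open>F\<close>, to \<open>T x\<close> for \<open>T \<in> I\<close>. As \<open>I\<close> is closed
  under products, they are also orthogonal to \<open>T (X n x)\<close> and so to the limit \<open>T (z x)\<close>. Hence
  \<open>\<Sum>x\<in>F. \<langle>x - z x, T (x - z x)\<rangle> = 0\<close>, and \<open>T = S\<^sup>* S\<close> gives \<open>S (x - z x) = 0\<close>. This
  replaces an approximate unit of \<open>I\<close>, without functional calculus.
\<close>

lemma ideal_projects_onto_finite_family:
  fixes I :: "('a::complex_hilbert \<Rightarrow>\<^sub>L 'a) set"
  assumes ops: "I \<subseteq> bounded_ops" and "I \<noteq> {}" and "finite F"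
    and add: "\<And>S T. S \<in> I \<Longrightarrow> T \<in> I \<Longrightarrow> S + T \<in> I"
    and scaleR: "\<And>r T. T \<in> I \<Longrightarrow> r *\<^sub>R T \<in> I"
    and compose: "\<And>S T. S \<in> I \<Longrightarrow> T \<in> I \<Longrightarrow> S o\<^sub>L T \<in> I"
    and adj: "\<And>T. T \<in> I \<Longrightarrow> adj T \<in> I"
  obtains z X where "\<And>n. X n \<in> I" and "\<And>x. x \<in> F \<Longrightarrow> (\<lambda>n. X n x) \<longlonglongrightarrow> z x"
    and "\<And>x S. x \<in> F \<Longrightarrow> S \<in> I \<Longrightarrow> S (x - z x) = 0"
proof -
  define V where "V = blinfun_apply ` I"
  have "V \<noteq> {}"
    using \<open>I \<noteq> {}\<close> by (simp add: V_def)
  have V_add: "(\<lambda>x. u x + v x) \<in> V" if uv: "u \<in> V" "v \<in> V" for u v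
  proof -
    obtain S T where "S \<in> I" "T \<in> I" "u = blinfun_apply S" "v = blinfun_apply T"
      using uv by (auto simp: V_def)
    then show ?thesis
      unfolding V_def by (intro image_eqI[of _ _ "S + T"] add) (auto simp: blinfun.add_left)
  qed
  have V_scale: "(\<lambda>x. r *\<^sub>R v x) \<in> V" if v: "v \<in> V" for r v
  proof -
    obtain T where "T \<in> I" "v = blinfun_apply T"
      using v by (auto simp: V_def)
    then show ?thesis
      unfolding V_def by (intro image_eqI[of _ _ "r *\<^sub>R T"] scaleR) (auto simp: blinfun.scaleR_left)
  qed
  obtain z v where v: "\<And>n. v n \<in> V" and lim: "\<And>x. x \<in> F \<Longrightarrow> (\<lambda>n. v n x) \<longlonglongrightarrow> z x"
    and orth: "\<And>u. u \<in> V \<Longrightarrow> (\<Sum>x\<in>F. inner (x - z x) (u x)) = 0"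
    by (rule projection_onto_family_space[of F V "\<lambda>x. x", OF \<open>finite F\<close> \<open>V \<noteq> {}\<close> V_add V_scale])
      (assumption | rule that)+
  have "\<forall>n. \<exists>T\<in>I. v n = blinfun_apply T"
    using v by (auto simp: V_def)
  then obtain X where X: "\<And>n. X n \<in> I" and v_X: "\<And>n. v n = blinfun_apply (X n)"
    by metis
  have orthI: "(\<Sum>x\<in>F. inner (x - z x) (T x)) = 0" if "T \<in> I" for T
    using that by (intro orth) (simp add: V_def)
  show thesis
  proof (rule that[OF X])
    show "(\<lambda>n. X n x) \<longlonglongrightarrow> z x" if "x \<in> F" for x
      using lim[OF that] by (simp add: v_X)
    fix x S
    assume "x \<in> F" "S \<in> I"
    define T where "T = adj S o\<^sub>L S"
    have "T \<in> I"
      unfolding T_def using \<open>S \<in> I\<close> by (intro compose adj)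
    have "(\<lambda>n. \<Sum>x\<in>F. inner (x - z x) (T (v n x))) \<longlonglongrightarrow> (\<Sum>x\<in>F. inner (x - z x) (T (z x)))"
      by (intro tendsto_intros lim)
    moreover have "(\<Sum>x\<in>F. inner (x - z x) (T (v n x))) = 0" for n
      using orthI[OF compose[OF \<open>T \<in> I\<close> X[of n]]] by (simp add: v_X)
    ultimately have Tz: "(\<Sum>x\<in>F. inner (x - z x) (T (z x))) = 0"
      by (simp add: LIMSEQ_const_iff)
    have sq: "inner w (T w) = (norm (S w))\<^sup>2" for w
      using ops \<open>S \<in> I\<close> unfolding T_def power2_norm_eq_inner by (subst inner_adj) auto
    have "(\<Sum>x\<in>F. inner (x - z x) (T (x - z x))) = 0"
      using orthI[OF \<open>T \<in> I\<close>] Tz by (simp add: blinfun.diff_right inner_diff_right sum_subtractf)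
    then have "(\<Sum>x\<in>F. (norm (S (x - z x)))\<^sup>2) = 0"
      unfolding sq .
    then show "S (x - z x) = 0"
      using \<open>finite F\<close> \<open>x \<in> F\<close> by (simp add: sum_nonneg_eq_0_iff)
  qed
qed

text \<open>
  The projection \<open>E\<close> onto the orthogonal complement of the common kernel of \<open>I\<close> is in \<open>I\<close> and
  central in \<open>M\<close>. So it is a scalar, and as it acts as the identity on the ranges of the elements of
  \<open>I\<close>, the scalar is 1.
\<close>

lemma id_mem_weakly_closed_ideal_of_factor:
  fixes M I :: "('a::complex_hilbert \<Rightarrow>\<^sub>L 'a) set"
  assumes M: "factor M" and IM: "I \<subseteq> M" and closed: "closedin weak_operator_topology I"
    and c: "c \<in> I" "c \<noteq> 0"
    and add: "\<And>S T. S \<in> I \<Longrightarrow> T \<in> I \<Longrightarrow> S + T \<in> I"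
    and left: "\<And>S T. S \<in> M \<Longrightarrow> T \<in> I \<Longrightarrow> S o\<^sub>L T \<in> I"
    and right: "\<And>S T. S \<in> I \<Longrightarrow> T \<in> M \<Longrightarrow> S o\<^sub>L T \<in> I"
    and adj: "\<And>T. T \<in> I \<Longrightarrow> adj T \<in> I"
  shows "id_blinfun \<in> I"
proof -
  have vna: "von_neumann_algebra M" and center: "M \<inter> commutant M = range scalar_op"
    using M by (auto simp: factor_def)
  have ops: "T \<in> bounded_ops" if "T \<in> M" for T
    using vna_bounded_ops[OF vna that] .
  have scaleR: "r *\<^sub>R T \<in> I" if T: "T \<in> I" for r T
  proof -
    have "r *\<^sub>R T = (r *\<^sub>R id_blinfun) o\<^sub>L T"
      by (rule blinfun_eqI) (simp add: blinfun.scaleR_left)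
    then show ?thesis
      using left[OF vna_scaleR[OF vna vna_id[OF vna]] T] by simp
  qed
  \<comment> \<open>The common kernel of \<open>I\<close> and its orthogonal complement; both are invariant under \<open>M\<close>.\<close>
  define W where "W = {w. \<forall>S\<in>I. blinfun_apply S w = 0}"
  define K where "K = {k. \<forall>w\<in>W. inner w k = 0}"
  have subspaces: "subspace W" "subspace K"
    by (auto simp: W_def K_def subspace_def blinfun.bilinear_simps inner_simps)
  have W_M: "T w \<in> W" if "T \<in> M" "w \<in> W" for T w
  proof -
    have "S (T w) = 0" if "S \<in> I" for S
      using right[OF that \<open>T \<in> M\<close>] \<open>w \<in> W\<close> by (force simp: W_def)
    then show ?thesis
      by (simp add: W_def)
  qed
  have K_M: "T k \<in> K" if "T \<in> M" "k \<in> K" for T k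
  proof -
    have "inner w (T k) = 0" if "w \<in> W" for w
    proof -
      have "inner (adj T w) k = 0"
        using W_M[OF vna_adj[OF vna \<open>T \<in> M\<close>] that] \<open>k \<in> K\<close> by (simp add: K_def)
      then show ?thesis
        using inner_adj[OF ops[OF \<open>T \<in> M\<close>], of k w] by (simp add: inner_commute[of w] inner_commute[of k])
    qed
    then show ?thesis
      by (simp add: K_def)
  qed
  have range_K: "T y \<in> K" if "T \<in> I" for T y
  proof -
    have "inner w (T y) = 0" if "w \<in> W" for w
      using adj[OF \<open>T \<in> I\<close>] that inner_adj[OF ops, of T y w] IM \<open>T \<in> I\<close>
      by (auto simp: W_def inner_commute)
    then show ?thesis
      by (simp add: K_def)
  qed
  have approx: "\<exists>z X. (\<forall>n::nat. X n \<in> I) \<and>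
      (\<forall>x\<in>F. (\<lambda>n. blinfun_apply (X n) x) \<longlonglongrightarrow> z x \<and> z x \<in> K \<and> x - z x \<in> W)"
    if "finite F" for F
  proof -
    obtain z X where X: "\<And>n. X n \<in> I" and lim: "\<And>x. x \<in> F \<Longrightarrow> (\<lambda>n. blinfun_apply (X n) x) \<longlonglongrightarrow> z x"
      and ker: "\<And>x S. x \<in> F \<Longrightarrow> S \<in> I \<Longrightarrow> blinfun_apply S (x - z x) = 0"
    proof (rule ideal_projects_onto_finite_family[OF _ _ \<open>finite F\<close> add scaleR _ adj])
      show "I \<subseteq> bounded_ops" "I \<noteq> {}" "\<And>S T. S \<in> I \<Longrightarrow> T \<in> I \<Longrightarrow> S o\<^sub>L T \<in> I"
        using IM ops c(1) left by auto
    qed (assumption | rule that)+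
    have "z x \<in> K" if "x \<in> F" for x
    proof -
      have "inner w (z x) = 0" if "w \<in> W" for w
      proof (rule LIMSEQ_unique)
        show "(\<lambda>n. inner w (X n x)) \<longlonglongrightarrow> inner w (z x)"
          by (intro tendsto_intros lim \<open>x \<in> F\<close>)
        have "inner w (X n x) = 0" for n
          using range_K[OF X] \<open>w \<in> W\<close> by (simp add: K_def)
        then show "(\<lambda>n. inner w (X n x)) \<longlonglongrightarrow> 0"
          by simp
      qed
      then show ?thesis
        by (simp add: K_def)
    qed
    then show ?thesis
      using X lim ker by (intro exI[of _ z] exI[of _ X]) (auto simp: W_def)
  qed
  have dec: "\<exists>k\<in>K. x - k \<in> W" for x
    using approx[of "{x}"] by auto
  obtain E :: "'a \<Rightarrow>\<^sub>L 'a" where EK: "\<And>x. E x \<in> K" and EW: "\<And>x. x - E x \<in> W"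
      and E_eq: "\<And>x k. k \<in> K \<Longrightarrow> x - k \<in> W \<Longrightarrow> E x = k"
    by (rule operator_of_orthogonal_decomposition[OF subspaces _ dec])
      (auto simp: K_def)
  have E_commute: "E (T x) = T (E x)" if "T \<in> M" for T x
    using that K_M[OF that EK] W_M[OF that EW] by (intro E_eq) (simp_all flip: blinfun.diff_right)
  have "scalar_op s \<in> M" for s
    using center by blast
  then have "E \<in> bounded_ops"
    using E_commute[of "scalar_op _"] by (simp add: bounded_ops_def)
  have "E \<in> I"
  proof (rule mem_weakly_closed_if_pointwise_limit[OF closed \<open>E \<in> bounded_ops\<close>])
    fix F :: "'a set"
    assume "finite F"
    then obtain z X where "\<forall>n::nat. X n \<in> I"
      "\<forall>x\<in>F. (\<lambda>n. blinfun_apply (X n) x) \<longlonglongrightarrow> z x \<and> z x \<in> K \<and> x - z x \<in> W"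
      using approx by blast
    then show "\<exists>X. (\<forall>n. X n \<in> I) \<and> (\<forall>x\<in>F. (\<lambda>n::nat. blinfun_apply (X n) x) \<longlonglongrightarrow> E x)"
      by (intro exI[of _ X]) (auto simp: E_eq)
  qed
  moreover have "E \<in> commutant M"
    using \<open>E \<in> bounded_ops\<close> E_commute by (auto simp: commutant_def intro!: blinfun_eqI)
  ultimately obtain s where s: "E = scalar_op s"
    using center IM by blast
  obtain y where "c y \<noteq> 0"
    using c(2) by (metis blinfun_eqI zero_blinfun.rep_eq)
  have "scaleC s (c y) = c y"
    using E_eq[OF range_K[OF c(1)], of "c y" y] subspace_0[OF subspaces(1)] by (simp add: s)
  then have "scaleC (s - 1) (c y) = 0"
    using scaleC_add_left[of "s - 1" 1 "c y"] by simp
  then have "s = 1"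
    using \<open>c y \<noteq> 0\<close> norm_scaleC[of "s - 1" "c y"] by simp
  then have "E = id_blinfun"
    by (intro blinfun_eqI) (simp add: s)
  then show ?thesis
    using \<open>E \<in> I\<close> by simp
qed

section \<open>Subalgebras invariant under unitary conjugation\<close>

abbreviation commutator :: "('a::complex_hilbert \<Rightarrow>\<^sub>L 'a) \<Rightarrow> ('a \<Rightarrow>\<^sub>L 'a) \<Rightarrow> 'a \<Rightarrow>\<^sub>L 'a" where
  "commutator a x \<equiv> (a o\<^sub>L x) - (x o\<^sub>L a)"

text \<open>
  With \<open>k = ith\<close>, \<open>R = (1 - k)\<^sup>-\<^sup>1\<close> and \<open>R' = (1 + k)\<^sup>-\<^sup>1\<close>, the unitary is
  \<open>U = (1 + k) R = R (1 + k)\<close> with adjoint \<open>R' (1 - k) = (1 - k) R'\<close>, because \<open>k\<^sup>* = -k\<close>. Then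
  \<open>U x U\<^sup>* - x = R ((1 + k) x (1 - k) - (1 - k) x (1 + k)) R' = 2 R [k, x] R'\<close>. The identity is
  exact, so no differentiation is needed. The number \<open>e\<close> bounds the norm of \<open>k\<close>.
\<close>

lemma cayley_transform:
  fixes M :: "('a::complex_hilbert \<Rightarrow>\<^sub>L 'a) set"
  assumes M: "von_neumann_algebra M" and h: "h \<in> M" "adj h = h"
    and e: "\<bar>t\<bar> * norm h \<le> e" "e < 1"
  obtains U R R' where "U \<in> unitaries M"
    and "norm (R - id_blinfun) \<le> e / (1 - e)" and "norm (R' - id_blinfun) \<le> e / (1 - e)"
    and "\<And>x. x \<in> M \<Longrightarrow> (U o\<^sub>L x o\<^sub>L adj U) - x =
      scalar_op (2 * \<i> * t) o\<^sub>L (R o\<^sub>L commutator h x o\<^sub>L R')"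
proof -
  define k where "k = scalar_op (\<i> * t) o\<^sub>L h"
  have ops: "T \<in> bounded_ops" if "T \<in> M" for T
    using vna_bounded_ops[OF M that] .
  have k_M: "k \<in> M"
    unfolding k_def by (intro vna_scalar M h)
  have mk_M: "- k \<in> M"
    using vna_diff[OF M vna_zero[OF M] k_M] by simp
  have k_apply: "k x = scaleC (\<i> * t) (h x)" for x
    by (simp add: k_def)
  have norm_k: "norm k \<le> e"
  proof (rule norm_blinfun_bound)
    show "norm (k x) \<le> e * norm x" for x
    proof -
      have "norm (k x) = \<bar>t\<bar> * norm (h x)"
        by (simp add: k_apply norm_scaleC norm_mult)
      also have "\<dots> \<le> \<bar>t\<bar> * (norm h * norm x)"
        by (intro mult_left_mono norm_blinfun) auto
      also have "\<dots> \<le> e * norm x"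
        using e(1) by (simp add: mult_right_mono flip: mult.assoc)
      finally show ?thesis .
    qed
    show "0 \<le> e"
      using e(1) by (meson abs_ge_zero mult_nonneg_nonneg norm_ge_zero order_trans)
  qed
  have bound: "norm k / (1 - norm k) \<le> e / (1 - e)"
    using norm_k e(2) order_trans[OF norm_ge_zero norm_k] by (intro frac_le) auto
  have skew: "cinner (k x) y = - cinner x (k y)" for x y
    using cinner_adj[OF ops[OF h(1)], of x y]
    by (simp add: k_apply cinner_scaleC_left cinner_scaleC_right h(2))
  obtain R where R: "R \<in> M" "\<And>x. R (x - k x) = x" "\<And>x. R x - k (R x) = x"
      "norm (R - id_blinfun) \<le> norm k / (1 - norm k)"
    using vna_inverse_one_minus[OF M k_M] norm_k e(2) by auto
  obtain R' where R': "R' \<in> M" "\<And>x. R' (x + k x) = x" "\<And>x. R' x + k (R' x) = x"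
      "norm (R' - id_blinfun) \<le> norm k / (1 - norm k)"
    using vna_inverse_one_minus[OF M mk_M] norm_k e(2) by (auto simp: blinfun.minus_left)
  define U where "U = (id_blinfun + k) o\<^sub>L R"
  define V where "V = R' o\<^sub>L (id_blinfun - k)"
  have U: "U x = R x + k (R x)" and V: "V x = R' (x - k x)" for x
    by (simp_all add: U_def V_def blinfun.bilinear_simps)
  \<comment> \<open>\<open>1 + k\<close> commutes with \<open>(1 - k)\<inverse>\<close>, and \<open>1 - k\<close> with \<open>(1 + k)\<inverse>\<close>.\<close>
  have U': "U x = R (x + k x)" for x
  proof -
    define u where "u = R x"
    have x: "x = u - k u"
      by (simp add: u_def R(3))
    have "x + k x = (u + k u) - k (u + k u)"
      unfolding x by (simp add: blinfun.bilinear_simps)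
    then show ?thesis
      by (simp add: U R(2) flip: u_def)
  qed
  have V': "V x = R' x - k (R' x)" for x
  proof -
    define v where "v = R' x"
    have x: "x = v + k v"
      by (simp add: v_def R'(3))
    have "x - k x = (v - k v) + k (v - k v)"
      unfolding x by (simp add: blinfun.bilinear_simps)
    then show ?thesis
      by (simp add: V R'(2) flip: v_def)
  qed
  have VU: "V (U x) = x" for x
  proof -
    define u where "u = R x"
    have x: "x = u - k u"
      by (simp add: u_def R(3))
    have "U x = u + k u"
      by (simp add: U u_def)
    then have "U x - k (U x) = x + k x"
      unfolding x by (simp add: blinfun.bilinear_simps)
    then show ?thesis
      by (simp add: V R'(2))
  qed
  have UV: "U (V x) = x" for x
  proof -
    define v where "v = R' x"
    have x: "x = v + k v"
      by (simp add: v_def R'(3))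
    have "V x = v - k v"
      by (simp add: V' v_def)
    then have "V x + k (V x) = x - k x"
      unfolding x by (simp add: blinfun.bilinear_simps)
    then show ?thesis
      by (simp add: U' R(2))
  qed
  have adjU: "adj U = V"
  proof (rule adj_eqI)
    fix x y
    have "cinner (U x) y = cinner (R x) (y - k y)"
      by (simp add: U cinner_add_left cinner_diff_right skew)
    also have "y - k y = V y + k (V y)"
      unfolding V by (rule R'(3)[symmetric])
    also have "cinner (R x) (V y + k (V y)) = cinner (R x - k (R x)) (V y)"
      by (simp add: cinner_add_right cinner_diff_left skew)
    finally show "cinner (U x) y = cinner x (V y)"
      by (simp add: R(3))
  qed
  show thesis
  proof (rule that)
    have "U \<in> M"
      unfolding U_def by (intro vna_compose vna_add vna_id k_M R M)
    then show "U \<in> unitaries M"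
      by (auto simp: unitaries_def adjU VU UV intro: blinfun_eqI)
    show "norm (R - id_blinfun) \<le> e / (1 - e)" "norm (R' - id_blinfun) \<le> e / (1 - e)"
      using R(4) R'(4) bound by linarith+
    fix x
    assume "x \<in> M"
    show "(U o\<^sub>L x o\<^sub>L adj U) - x = scalar_op (2 * \<i> * t) o\<^sub>L (R o\<^sub>L commutator h x o\<^sub>L R')"
    proof (rule blinfun_eqI)
      fix a
      \<comment> \<open>Writing \<open>a = (1 + k) w\<close> makes both \<open>V a\<close> and \<open>x a\<close> polynomial in \<open>k\<close>.\<close>
      define w where "w = R' a"
      have a: "a = w + k w"
        by (simp add: w_def R'(3))
      have Va: "V a = w - k w"
        by (simp add: V' w_def)
      have "U (x (V a)) - x a = R (x (V a) + k (x (V a))) - R (x a - k (x a))"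
        by (simp add: U' R(2))
      also have "\<dots> = R ((x (V a) + k (x (V a))) - (x a - k (x a)))"
        by (simp only: blinfun.diff_right)
      also have "(x (V a) + k (x (V a))) - (x a - k (x a)) = (k (x w) - x (k w)) + (k (x w) - x (k w))"
        unfolding Va unfolding a by (simp add: blinfun.bilinear_simps)
      also have "k (x w) - x (k w) = scaleC (\<i> * t) (h (x w) - x (h w))"
        by (simp add: k_apply scaleC_diff_right bounded_ops_scaleC[OF ops[OF \<open>x \<in> M\<close>]])
      also have "\<dots> + \<dots> = scaleC (2 * \<i> * t) (h (x w) - x (h w))"
        by (simp add: mult.assoc flip: scaleC_add_left)
      also have "R (scaleC (2 * \<i> * t) (h (x w) - x (h w))) = scaleC (2 * \<i> * t) (R (h (x w) - x (h w)))"
        by (rule bounded_ops_scaleC[OF ops[OF R(1)]])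
      finally show "((U o\<^sub>L x o\<^sub>L adj U) - x) a
          = (scalar_op (2 * \<i> * t) o\<^sub>L (R o\<^sub>L commutator h x o\<^sub>L R')) a"
        by (simp add: adjU w_def blinfun.diff_left)
    qed
  qed
qed

text \<open>
  The resolvents of the Cayley transform tend to the identity in norm as \<open>t\<close> tends to 0, so
  \<open>[h, x]\<close> is the norm limit of \<open>R [h, x] R' = (2it)\<^sup>-\<^sup>1 (U x U\<^sup>* - x)\<close>.
\<close>

lemma commutator_selfadjoint_mem:
  fixes M :: "('a::complex_hilbert \<Rightarrow>\<^sub>L 'a) set"
  assumes M: "von_neumann_algebra M" and N: "von_neumann_algebra N" "N \<subseteq> M"
    and conj: "\<And>U x. U \<in> unitaries M \<Longrightarrow> x \<in> N \<Longrightarrow> U o\<^sub>L x o\<^sub>L adj U \<in> N"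
    and h: "h \<in> M" "adj h = h" and x: "x \<in> N"
  shows "commutator h x \<in> N"
proof -
  \<comment> \<open>Chosen so that \<open>\<bar>t n\<bar> \<parallel>h\<parallel> \<le> e n < 1\<close>, with the neat bound \<open>e n / (1 - e n) = 1 / (n + 1)\<close>.\<close>
  define t where "t n = inverse (real (n + 2) * (norm h + 1))" for n
  define e where "e n = inverse (real (n + 2))" for n
  have t_pos: "t n > 0" for n
    by (auto simp: t_def intro!: mult_pos_pos add_nonneg_pos)
  have te: "\<bar>t n\<bar> * norm h \<le> e n" "e n < 1" "e n / (1 - e n) = inverse (real (Suc n))" for n
  proof -
    have "norm h / (norm h + 1) \<le> 1"
      by (simp add: divide_le_eq_1 add_nonneg_pos)
    then have "e n * (norm h / (norm h + 1)) \<le> e n"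
      by (intro mult_left_le) (auto simp: e_def)
    then show "\<bar>t n\<bar> * norm h \<le> e n"
      using t_pos[of n] by (simp add: t_def e_def divide_inverse mult_ac)
    show "e n < 1" "e n / (1 - e n) = inverse (real (Suc n))"
      by (simp_all add: e_def field_simps)
  qed
  have "\<exists>R R'. R o\<^sub>L commutator h x o\<^sub>L R' \<in> N \<and>
      norm (R - id_blinfun) \<le> inverse (real (Suc n)) \<and> norm (R' - id_blinfun) \<le> inverse (real (Suc n))"
    for n
  proof -
    obtain U R R' where U: "U \<in> unitaries M"
        and R: "norm (R - id_blinfun) \<le> e n / (1 - e n)" "norm (R' - id_blinfun) \<le> e n / (1 - e n)"
        and *: "\<And>x. x \<in> M \<Longrightarrow> (U o\<^sub>L x o\<^sub>L adj U) - x =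
          scalar_op (2 * \<i> * t n) o\<^sub>L (R o\<^sub>L commutator h x o\<^sub>L R')"
      using cayley_transform[OF M h te(1,2)] by metis
    have "x \<in> M"
      using N(2) x by blast
    have "scalar_op (inverse (2 * \<i> * t n)) o\<^sub>L ((U o\<^sub>L x o\<^sub>L adj U) - x) \<in> N"
      by (intro vna_scalar vna_diff conj N(1) U x)
    also have "scalar_op (inverse (2 * \<i> * t n)) o\<^sub>L ((U o\<^sub>L x o\<^sub>L adj U) - x)
        = R o\<^sub>L commutator h x o\<^sub>L R'"
      unfolding *[OF \<open>x \<in> M\<close>] using t_pos[of n]
      by (intro blinfun_eqI) (simp add: scaleC_scaleC del: inverse_mult_distrib)
    finally show ?thesis
      using R te(3)[of n] by auto
  qed
  then obtain R R' where mem: "\<And>n. R n o\<^sub>L commutator h x o\<^sub>L R' n \<in> N"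
      and R: "\<And>n. norm (R n - id_blinfun) \<le> inverse (real (Suc n))"
        "\<And>n. norm (R' n - id_blinfun) \<le> inverse (real (Suc n))"
    by metis
  have "R \<longlonglongrightarrow> id_blinfun" "R' \<longlonglongrightarrow> id_blinfun"
    using R by (auto intro!: Lim_null_comparison[OF _ LIMSEQ_inverse_real_of_nat]
        simp: Lim_null[where l = id_blinfun])
  then have "(\<lambda>n. R n o\<^sub>L commutator h x o\<^sub>L R' n) \<longlonglongrightarrow> (id_blinfun o\<^sub>L commutator h x o\<^sub>L id_blinfun)"
    by (intro bounded_bilinear.tendsto[OF bounded_bilinear_blinfun_compose] tendsto_const)
  then show ?thesis
    by (intro mem_weakly_closed_if_norm_limit[OF vna_closed[OF N(1)] mem]) simp
qed

text \<open>Here \<open>2 a = h - i g\<close> with \<open>h = a + a\<^sup>*\<close> and \<open>g = i (a - a\<^sup>*)\<close> self-adjoint.\<close>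

lemma commutator_mem:
  fixes M :: "('a::complex_hilbert \<Rightarrow>\<^sub>L 'a) set"
  assumes M: "von_neumann_algebra M" and N: "von_neumann_algebra N" "N \<subseteq> M"
    and conj: "\<And>U x. U \<in> unitaries M \<Longrightarrow> x \<in> N \<Longrightarrow> U o\<^sub>L x o\<^sub>L adj U \<in> N"
    and a: "a \<in> M" and x: "x \<in> N"
  shows "commutator a x \<in> N"
proof -
  define h where "h = a + adj a"
  define g where "g = (scalar_op \<i> o\<^sub>L a) + (scalar_op (-\<i>) o\<^sub>L adj a)"
  have ops: "a \<in> bounded_ops" "adj a \<in> bounded_ops" "x \<in> bounded_ops"
    using vna_bounded_ops[OF M] vna_bounded_ops[OF N(1)] vna_adj[OF M] a x by auto
  have "(scalar_op s :: 'a \<Rightarrow>\<^sub>L 'a) \<in> bounded_ops" for s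
    by (simp add: bounded_ops_def scaleC_scaleC mult.commute)
  then have "adj h = h" "adj g = g"
    using ops by (auto simp: h_def g_def adj_add adj_scalar adj_adj bounded_ops_compose add.commute)
  moreover have "h \<in> M" "g \<in> M"
    unfolding h_def g_def by (intro vna_add vna_scalar vna_adj M a)+
  ultimately have "commutator h x \<in> N" "commutator g x \<in> N"
    using commutator_selfadjoint_mem[OF M N conj] x by auto
  then have "(1/2) *\<^sub>R (commutator h x + (scalar_op (-\<i>) o\<^sub>L commutator g x)) \<in> N"
    by (intro vna_scaleR vna_add vna_scalar N(1))
  also have "commutator h x + (scalar_op (-\<i>) o\<^sub>L commutator g x) = commutator a x + commutator a x"
    by (rule blinfun_eqI)
      (simp add: h_def g_def blinfun.bilinear_simps bounded_ops_scaleC[OF ops(3)] scaleC_add_right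
        scaleC_diff_right scaleC_scaleC scaleC_minus_left)
  also have "(1/2) *\<^sub>R (commutator a x + commutator a x) = commutator a x"
    by (rule scaleR_half_double)
  finally show ?thesis .
qed

text \<open>
  Herstein's argument: \<open>a [x, y] = [a x, y] - [a, y] x\<close> is in \<open>N\<close>, and for \<open>c = a [x, y]\<close> so is
  \<open>c b = b c - [b, c]\<close>, because \<open>b c = (b a) [x, y]\<close> is of the kind just treated.
\<close>

lemma sandwiched_commutator_mem:
  fixes N M :: "('a::complex_hilbert \<Rightarrow>\<^sub>L 'a) set"
  assumes M: "von_neumann_algebra M" and N: "von_neumann_algebra N"
    and lie: "\<And>a x. a \<in> M \<Longrightarrow> x \<in> N \<Longrightarrow> commutator a x \<in> N"
    and "N \<subseteq> M" "x \<in> N" "y \<in> N" "a \<in> M" "b \<in> M"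
  shows "a o\<^sub>L commutator x y o\<^sub>L b \<in> N"
proof -
  have left: "a o\<^sub>L commutator x y \<in> N" if "a \<in> M" for a
  proof -
    have "commutator (a o\<^sub>L x) y - (commutator a y o\<^sub>L x) \<in> N"
      using that assms by (intro vna_diff vna_compose N lie vna_compose[OF M]) auto
    also have "commutator (a o\<^sub>L x) y - (commutator a y o\<^sub>L x) = a o\<^sub>L commutator x y"
      by (rule blinfun_eqI) (simp add: blinfun.bilinear_simps)
    finally show ?thesis .
  qed
  define c where "c = a o\<^sub>L commutator x y"
  have "b o\<^sub>L c \<in> N"
    using left[OF vna_compose[OF M \<open>b \<in> M\<close> \<open>a \<in> M\<close>]] by (simp add: c_def blinfun_compose_assoc)
  then have "(b o\<^sub>L c) - commutator b c \<in> N"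
    using assms left by (intro vna_diff lie N) (auto simp: c_def)
  also have "(b o\<^sub>L c) - commutator b c = a o\<^sub>L commutator x y o\<^sub>L b"
    by (simp add: c_def)
  finally show ?thesis .
qed

text \<open>
  Expanding \<open>[P, [a, P]] = 0\<close> gives \<open>P a + a P = 2 P a P\<close>; multiplying by \<open>P\<close> on the left and on
  the right, respectively, gives \<open>P a = P a P = a P\<close>.
\<close>

lemma commute_if_commutator_commutes:
  fixes P a :: "'a::complex_hilbert \<Rightarrow>\<^sub>L 'a"
  assumes PP: "P o\<^sub>L P = P" and comm: "commutator P (commutator a P) = 0"
  shows "a o\<^sub>L P = P o\<^sub>L a"
proof -
  have P: "P (P x) = P x" for x
    using PP by (metis blinfun_apply_blinfun_compose)
  have sum: "P (a x) + a (P x) = P (a (P x)) + P (a (P x))" for x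
    using arg_cong[OF comm, of "\<lambda>T. blinfun_apply T x"]
    by (simp add: blinfun.bilinear_simps P algebra_simps)
  have "P (a x) = P (a (P x))" for x
    using arg_cong[OF sum[of x], of "blinfun_apply P"] by (simp add: blinfun.bilinear_simps P)
  moreover have "a (P x) = P (a (P x))" for x
    using sum[of "P x"] by (simp add: P)
  ultimately show ?thesis
    by (intro blinfun_eqI) simp
qed

theorem lemma3p1:
  fixes M :: "('a::complex_hilbert \<Rightarrow>\<^sub>L 'a) set"
    and P :: "'a \<Rightarrow>\<^sub>L 'a"
  assumes "factor M"
    and "separable_predual M"
    and "projection P"
    and "P \<in> M"
    and "P \<noteq> 0"
    and "P \<noteq> id_blinfun"
  shows "generated_von_neumann_algebra {U o\<^sub>L P o\<^sub>L adj U | U. U \<in> unitaries M} = M"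
proof -
  define S where "S = {U o\<^sub>L P o\<^sub>L adj U | U. U \<in> unitaries M}"
  define N where "N = generated_von_neumann_algebra S"
  have M: "von_neumann_algebra M" and center: "M \<inter> commutant M = range scalar_op"
    using \<open>factor M\<close> by (auto simp: factor_def)
  have unitary_M: "U \<in> M" "adj U o\<^sub>L U = id_blinfun" "U o\<^sub>L adj U = id_blinfun"
    if "U \<in> unitaries M" for U
    using that by (auto simp: unitaries_def)
  have ops: "T \<in> bounded_ops" if "T \<in> M" for T
    using vna_bounded_ops[OF M that] .
  have "S \<subseteq> M"
    using \<open>P \<in> M\<close> unitary_M(1) by (auto simp: S_def intro!: vna_compose[OF M] vna_adj[OF M])
  note N = generated_vna[OF M \<open>S \<subseteq> M\<close>, folded N_def]
  have "adj id_blinfun = (id_blinfun :: 'a \<Rightarrow>\<^sub>L 'a)"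
    by (rule adj_eqI) simp
  then have "id_blinfun \<in> unitaries M"
    using vna_id[OF M] by (auto simp: unitaries_def intro: blinfun_eqI)
  moreover have "P = id_blinfun o\<^sub>L P o\<^sub>L adj id_blinfun"
    unfolding \<open>adj id_blinfun = id_blinfun\<close> by simp
  ultimately have "P \<in> N"
    using N(3) by (auto simp: S_def)
  have conj: "U o\<^sub>L x o\<^sub>L adj U \<in> N" if U: "U \<in> unitaries M" and x: "x \<in> N" for U x
  proof -
    have "U o\<^sub>L x o\<^sub>L adj U \<in> K" if K: "von_neumann_algebra K" and SK: "S \<subseteq> K" for K
    proof -
      \<comment> \<open>The algebra \<open>U\<^sup>* K U\<close>, which contains the generators because they are permuted by \<open>U\<close>.\<close>
      define K' where "K' = {T \<in> bounded_ops. U o\<^sub>L T o\<^sub>L adj U \<in> K}"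
      have "von_neumann_algebra K'"
        unfolding K'_def using U by (intro vna_unitary_conjugate[OF K] ops unitary_M)
      moreover have "S \<subseteq> K'"
      proof
        fix T
        assume "T \<in> S"
        then obtain V where V: "V \<in> unitaries M" and T: "T = V o\<^sub>L P o\<^sub>L adj V"
          by (auto simp: S_def)
        have adj_UV: "adj (U o\<^sub>L V) = adj V o\<^sub>L adj U"
          using U V by (intro adj_compose ops unitary_M)
        have "adj (U o\<^sub>L V) o\<^sub>L (U o\<^sub>L V) = adj V o\<^sub>L ((adj U o\<^sub>L U) o\<^sub>L V)"
          and "(U o\<^sub>L V) o\<^sub>L adj (U o\<^sub>L V) = U o\<^sub>L ((V o\<^sub>L adj V) o\<^sub>L adj U)"
          by (simp_all add: adj_UV blinfun_compose_assoc)
        then have "U o\<^sub>L V \<in> unitaries M"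
          using U V vna_compose[OF M, of U V] by (simp add: unitaries_def)
        moreover have "U o\<^sub>L T o\<^sub>L adj U = (U o\<^sub>L V) o\<^sub>L P o\<^sub>L adj (U o\<^sub>L V)"
          by (simp add: T adj_UV blinfun_compose_assoc)
        ultimately have "U o\<^sub>L T o\<^sub>L adj U \<in> S"
          by (auto simp: S_def)
        then show "T \<in> K'"
          using SK \<open>T \<in> S\<close> \<open>S \<subseteq> M\<close> ops by (auto simp: K'_def)
      qed
      ultimately have "x \<in> K'"
        using x by (auto simp: N_def generated_von_neumann_algebra_def)
      then show ?thesis
        by (simp add: K'_def)
    qed
    then show ?thesis
      by (auto simp: N_def generated_von_neumann_algebra_def)
  qed
  have lie: "commutator a x \<in> N" if "a \<in> M" "x \<in> N" for a x
    using commutator_mem[OF M N(1,2) conj] that by blast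
  \<comment> \<open>The largest two-sided ideal of \<open>M\<close> contained in \<open>N\<close>.\<close>
  define I where "I = {c \<in> M. \<forall>a\<in>M. \<forall>b\<in>M. a o\<^sub>L c o\<^sub>L b \<in> N}"
  have comm_I: "commutator x y \<in> I" if "x \<in> N" "y \<in> N" for x y
    using that N(2) sandwiched_commutator_mem[OF M N(1) lie N(2)]
    by (auto simp: I_def intro!: vna_diff[OF M] vna_compose[OF M])
  have "I \<noteq> {0}"
  proof
    assume "I = {0}"
    have PP: "P o\<^sub>L P = P"
      using \<open>projection P\<close> by (simp add: projection_def)
    have "a o\<^sub>L P = P o\<^sub>L a" if "a \<in> M" for a
      using comm_I[OF \<open>P \<in> N\<close> lie[OF that \<open>P \<in> N\<close>]] \<open>I = {0}\<close>
      by (intro commute_if_commutator_commutes PP) simp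
    then have "P \<in> M \<inter> commutant M"
      using \<open>P \<in> M\<close> ops by (auto simp: commutant_def)
    then obtain s where s: "P = scalar_op s"
      using center by blast
    obtain y where "P y \<noteq> 0"
      using \<open>P \<noteq> 0\<close> by (metis blinfun_eqI zero_blinfun.rep_eq)
    have "P (P y) = P y"
      using PP by (metis blinfun_apply_blinfun_compose)
    then have "scaleC (s - 1) (P y) = 0"
      using scaleC_add_left[of "s - 1" 1 "P y"] by (simp add: s)
    then have "s = 1"
      using \<open>P y \<noteq> 0\<close> norm_scaleC[of "s - 1" "P y"] by simp
    then have "P = id_blinfun"
      by (intro blinfun_eqI) (simp add: s)
    then show False
      using \<open>P \<noteq> id_blinfun\<close> by simp
  qed
  moreover have "0 \<in> I"
    using vna_zero[OF M] vna_zero[OF N(1)]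
    by (simp add: I_def bounded_bilinear.zero_left[OF bounded_bilinear_blinfun_compose]
        bounded_bilinear.zero_right[OF bounded_bilinear_blinfun_compose])
  ultimately obtain c where c: "c \<in> I" "c \<noteq> 0"
    by blast
  have "id_blinfun \<in> I"
  proof (rule id_mem_weakly_closed_ideal_of_factor[OF \<open>factor M\<close> _ _ c])
    show "I \<subseteq> M"
      by (auto simp: I_def)
    have "I = \<Inter>(insert M ((\<lambda>(a, b). {T \<in> bounded_ops. a o\<^sub>L T o\<^sub>L b \<in> N}) ` (M \<times> M)))"
      using ops by (auto simp: I_def)
    moreover have "closedin weak_operator_topology \<dots>"
      by (intro closedin_Inter) (auto intro: vna_closed[OF M] closedin_sandwich vna_closed[OF N(1)] ops)
    ultimately show "closedin weak_operator_topology I"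
      by simp
    fix T
    assume T: "T \<in> I"
    show "R + T \<in> I" if "R \<in> I" for R
    proof -
      have "a o\<^sub>L (R + T) o\<^sub>L b = (a o\<^sub>L R o\<^sub>L b) + (a o\<^sub>L T o\<^sub>L b)" for a b :: "'a \<Rightarrow>\<^sub>L 'a"
        by (rule blinfun_eqI) (simp add: blinfun.bilinear_simps)
      then show ?thesis
        using T that vna_add[OF M] vna_add[OF N(1)] by (simp add: I_def)
    qed
    show "R o\<^sub>L T \<in> I" if "R \<in> M" for R
    proof -
      have "a o\<^sub>L (R o\<^sub>L T) o\<^sub>L b = (a o\<^sub>L R) o\<^sub>L T o\<^sub>L b" for a b :: "'a \<Rightarrow>\<^sub>L 'a"
        by (simp add: blinfun_compose_assoc)
      then show ?thesis
        using T that vna_compose[OF M] by (simp add: I_def)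
    qed
    show "T o\<^sub>L R \<in> I" if "R \<in> M" for R
    proof -
      have "a o\<^sub>L (T o\<^sub>L R) o\<^sub>L b = a o\<^sub>L T o\<^sub>L (R o\<^sub>L b)" for a b :: "'a \<Rightarrow>\<^sub>L 'a"
        by (simp add: blinfun_compose_assoc)
      then show ?thesis
        using T that vna_compose[OF M] by (simp add: I_def)
    qed
    have "a o\<^sub>L adj T o\<^sub>L b \<in> N" if "a \<in> M" "b \<in> M" for a b
    proof -
      have "adj (adj b o\<^sub>L T o\<^sub>L adj a) \<in> N"
        using T that by (intro vna_adj[OF N(1)]) (auto simp: I_def vna_adj[OF M])
      also have "adj (adj b o\<^sub>L T o\<^sub>L adj a) = a o\<^sub>L adj T o\<^sub>L b"
        using T that ops
        by (simp add: I_def adj_compose adj_adj bounded_ops_compose adj_bounded_ops blinfun_compose_assoc)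
      finally show ?thesis .
    qed
    then show "adj T \<in> I"
      using T vna_adj[OF M] by (simp add: I_def)
  qed
  have "M \<subseteq> N"
  proof
    fix a
    assume "a \<in> M"
    then have "a o\<^sub>L id_blinfun o\<^sub>L id_blinfun \<in> N"
      using \<open>id_blinfun \<in> I\<close> vna_id[OF M] unfolding I_def by blast
    then show "a \<in> N"
      by simp
  qed
  then show ?thesis
    using N(2) by (simp add: N_def S_def)
qed

end
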